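(* Consider the problem of minimizing $x^2-y^2$ over $x,y\in\mathbb{R}$ subject to $x=y$, $x\in[-1,1]$. Then: 1. If the penalty parameters $\{\beta^k:k\in\mathbb{N}\}$ are bounded, the augmented Lagrangian method (ALM) generates a divergent (i.e. non-convergent) sequence. 2. For any fixed $\beta>4$, ADMM generates a sequence that converges, in finitely many steps, to a solution of the problem.
   Context: For $x\in[-1,1]$, $y,w\in\mathbb{R}$ the augmented Lagrangian is $\mathcal{L}_\beta(x,y,w)=x^2-y^2+w(x-y)+\frac{\beta}{2}|x-y|^2$. ALM: from $w^0\in\mathbb{R}$, for $k=0,1,\dots$: $(x^{k+1},y^{k+1})\in\operatorname{argmin}_{x\in[-1,1],\,y\in\mathbb{R}}\mathcal{L}_{\beta^k}(x,y,w^k)$ (the parameters $\beta^k$ being such that this subproblem has a minimizer, i.e. $\beta^k>2$), then $w^{k+1}=w^k+\tau(x^{k+1}-y^{k+1})$, where $\tau>0$ is the multiplier step size. The sequence generated is $(x^k,y^k,w^k)$. ADMM with penalty $\beta$: from $y^0,w^0\in\mathbb{R}$, for $k=0,1,\dots$: $x^{k+1}\in\operatorname{argmin}_{x\in[-1,1]}\mathcal{L}_\beta(x,y^k,w^k)$, $y^{k+1}\in\operatorname{argmin}_{y\in\mathbb{R}}\mathcal{L}_\beta(x^{k+1},y,w^k)$, $w^{k+1}=w^k+\beta(x^{k+1}-y^{k+1})$. *)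

theory Defs
  imports "HOL-Analysis.Analysis"
begin

definition objective :: "real \<times> real \<Rightarrow> real" where
  "objective = (\<lambda>(x, y). x\<^sup>2 - y\<^sup>2)"

definition feasible :: "real \<times> real \<Rightarrow> bool" where
  "feasible = (\<lambda>(x, y). x = y \<and> x \<in> {-1..1})"

definition is_solution :: "real \<times> real \<Rightarrow> bool" where
  "is_solution p \<longleftrightarrow> is_arg_min objective feasible p"

definition aug_lagrangian :: "real \<Rightarrow> real \<Rightarrow> real \<Rightarrow> real \<Rightarrow> real" where
  "aug_lagrangian \<beta> x y w = x\<^sup>2 - y\<^sup>2 + w * (x - y) + \<beta> / 2 * \<bar>x - y\<bar>\<^sup>2"

(* Minimizers need not be unique, so the algorithms are rendered as relations
   satisfied by every sequence they can generate. The values x 0 and y 0 are not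
   produced by ALM, nor x 0 by ADMM; they are left arbitrary. *)

definition ALM_sequence ::
  "real \<Rightarrow> (nat \<Rightarrow> real) \<Rightarrow> (nat \<Rightarrow> real) \<Rightarrow> (nat \<Rightarrow> real) \<Rightarrow> (nat \<Rightarrow> real) \<Rightarrow> bool" where
  "ALM_sequence \<tau> \<beta> x y w \<longleftrightarrow>
     (\<forall>k. is_arg_min (\<lambda>(u, v). aug_lagrangian (\<beta> k) u v (w k))
                     (\<lambda>(u, v). u \<in> {-1..1}) (x (Suc k), y (Suc k)) \<and>
          w (Suc k) = w k + \<tau> * (x (Suc k) - y (Suc k)))"

definition ADMM_sequence ::
  "real \<Rightarrow> (nat \<Rightarrow> real) \<Rightarrow> (nat \<Rightarrow> real) \<Rightarrow> (nat \<Rightarrow> real) \<Rightarrow> bool" where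
  "ADMM_sequence \<beta> x y w \<longleftrightarrow>
     (\<forall>k. is_arg_min (\<lambda>u. aug_lagrangian \<beta> u (y k) (w k)) (\<lambda>u. u \<in> {-1..1}) (x (Suc k)) \<and>
          is_arg_min (\<lambda>v. aug_lagrangian \<beta> (x (Suc k)) v (w k)) (\<lambda>v. True) (y (Suc k)) \<and>
          w (Suc k) = w k + \<beta> * (x (Suc k) - y (Suc k)))"

end

theory Submission
  imports Defs
begin

text \<open>
  In both algorithms every partial minimisation is a one-variable quadratic, so completing the
  square gives the iterates explicitly.

  For ALM, put \<open>r = x - y\<close>; the augmented Lagrangian becomes
  \<open>(\<beta>/2 - 1) r\<^sup>2 + (2 x + w) r\<close>, whose minimum over \<open>r\<close> is \<open>-(2 x + w)\<^sup>2 / (2 (\<beta> - 2))\<close>,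
  taken at \<open>r = -(2 x + w) / (\<beta> - 2)\<close>. The remaining problem in \<open>x\<close> is concave, so it drives
  \<open>x\<close> to the endpoint of the interval where \<open>\<bar>2 x + w\<bar>\<close> is largest, and that value is at least 2
  whatever \<open>w\<close> is. Hence the infeasibility \<open>\<bar>r\<bar>\<close> is at least \<open>2 / (\<beta> - 2)\<close> at every iteration
  (\<open>ALM_step_infeasibility\<close>). With bounded penalties this is bounded away from 0, so the
  multiplier makes steps that do not tend to 0.

  For ADMM, stationarity in the \<open>y\<close>-step says exactly that the updated multiplier is
  \<open>w = -2 y\<close>. From then on the method is a map of \<open>y\<close> alone: \<open>x\<close> becomes the projection of \<open>y\<close>
  to the interval, and \<open>y\<close> is replaced by \<open>(\<beta> x - 2 y) / (\<beta> - 2)\<close>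
  (\<open>ADMM_sequence_reduction\<close>). Points of the interval are fixed. A point outside
  is reflected at the nearer endpoint with its excess scaled by \<open>2 / (\<beta> - 2)\<close>, which is less than
  1 because \<open>\<beta> > 4\<close>. It thus lands in the interval or overshoots the far endpoint, and crossing
  the interval costs 2 units of excess (\<open>reflection_step_decrease\<close>). After finitely many steps
  \<open>y\<close> lies in the interval and all iterates are constant. The objective vanishes on the feasible
  set, so any feasible limit is a solution.
\<close>

section \<open>Minimisers of one-variable quadratics\<close>

lemma argmin_square_UNIV:
  fixes a c d v :: real
  assumes "a > 0" and min: "is_arg_min (\<lambda>u. a * (u - c)\<^sup>2 + d) (\<lambda>u. True) v"
  shows "v = c"
proof -
  have "\<not> a * (c - c)\<^sup>2 + d < a * (v - c)\<^sup>2 + d"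
    using min unfolding is_arg_min_def by blast
  then have "a * (v - c)\<^sup>2 \<le> 0" by simp
  then have "(v - c)\<^sup>2 \<le> 0"
    using \<open>a > 0\<close> by (simp add: mult_le_0_iff)
  then show ?thesis by simp
qed

lemma argmin_square_interval:
  fixes a c d l h u :: real
  assumes "a > 0" and "l \<le> h"
    and min: "is_arg_min (\<lambda>u. a * (u - c)\<^sup>2 + d) (\<lambda>u. u \<in> {l..h}) u"
  shows "u = max l (min h c)"
proof -
  define p where "p = max l (min h c)"
  have u: "l \<le> u" "u \<le> h" using min by (auto simp: is_arg_min_def)
  have p: "p \<in> {l..h}" using \<open>l \<le> h\<close> by (auto simp: p_def)
  then have "\<not> a * (p - c)\<^sup>2 + d < a * (u - c)\<^sup>2 + d"
    using min unfolding is_arg_min_def by blast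
  then have le: "(u - c)\<^sup>2 \<le> (p - c)\<^sup>2" using \<open>a > 0\<close> by simp
  \<comment> \<open>The variational inequality that characterises the projection \<open>p\<close> of \<open>c\<close>.\<close>
  have "(u - p) * (p - c) \<ge> 0"
    using u \<open>l \<le> h\<close> unfolding p_def max_def min_def
    by (auto simp: zero_le_mult_iff)
  moreover have "(u - c)\<^sup>2 = (u - p)\<^sup>2 + 2 * ((u - p) * (p - c)) + (p - c)\<^sup>2"
    by (simp add: power2_eq_square algebra_simps)
  ultimately have "(u - p)\<^sup>2 \<le> 0" using le by linarith
  then show ?thesis by (simp add: p_def)
qed

section \<open>Divergence of ALM\<close>

lemma aug_lagrangian_complete_square:
  assumes "\<beta> \<noteq> 2"
  shows "aug_lagrangian \<beta> x y w =
    (\<beta> - 2) / 2 * (x - y + (2 * x + w) / (\<beta> - 2))\<^sup>2 - (2 * x + w)\<^sup>2 / (2 * (\<beta> - 2))"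
proof -
  have square: "m / 2 * (r + s / m)\<^sup>2 - s\<^sup>2 / (2 * m) = m / 2 * r\<^sup>2 + s * r"
    if "m \<noteq> 0" for m r s :: real
    using that by (simp add: field_simps power2_eq_square)
  have "aug_lagrangian \<beta> x y w = (\<beta> - 2) / 2 * (x - y)\<^sup>2 + (2 * x + w) * (x - y)"
    by (simp add: aug_lagrangian_def power2_eq_square field_simps)
  also have "\<dots> = (\<beta> - 2) / 2 * (x - y + (2 * x + w) / (\<beta> - 2))\<^sup>2 - (2 * x + w)\<^sup>2 / (2 * (\<beta> - 2))"
    using assms by (subst square) auto
  finally show ?thesis .
qed

text \<open>
  A joint minimiser has the optimal \<open>y\<close> for its \<open>x\<close>, and is no worse than the pair built in the
  same way from the endpoint whose sign agrees with that of \<open>w\<close>. At that endpoint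
  \<open>\<bar>2 x + w\<bar> = 2 + \<bar>w\<bar>\<close>.
\<close>

lemma ALM_step_infeasibility:
  assumes "\<beta> > 2"
    and min: "is_arg_min (\<lambda>(u, v). aug_lagrangian \<beta> u v w) (\<lambda>(u, v). u \<in> {-1..1}) (x, y)"
  shows "\<bar>x - y\<bar> \<ge> 2 / (\<beta> - 2)"
proof -
  define m where "m = \<beta> - 2"
  have m: "m > 0" using assms by (simp add: m_def)
  have L: "aug_lagrangian \<beta> u v w = m / 2 * (u - v + (2 * u + w) / m)\<^sup>2 - (2 * u + w)\<^sup>2 / (2 * m)"
    for u v
    using aug_lagrangian_complete_square[of \<beta> u v w] assms(1) by (simp add: m_def)
  have le: "aug_lagrangian \<beta> x y w \<le> - (2 * u + w)\<^sup>2 / (2 * m)" if "u \<in> {-1..1}" for u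
  proof -
    have "\<not> aug_lagrangian \<beta> u (u + (2 * u + w) / m) w < aug_lagrangian \<beta> x y w"
      using min that by (auto simp: is_arg_min_def)
    then show ?thesis by (simp add: L[of u])
  qed
  have x: "x \<in> {-1..1}" using min by (simp add: is_arg_min_def)
  have "m / 2 * (x - y + (2 * x + w) / m)\<^sup>2 \<le> 0"
    using le[OF x] by (simp add: L)
  then have "(x - y + (2 * x + w) / m)\<^sup>2 \<le> 0"
    using m by (simp add: mult_le_0_iff)
  then have r: "x - y = - ((2 * x + w) / m)" by simp
  define s :: real where "s = (if w \<ge> 0 then 1 else -1)"
  have "aug_lagrangian \<beta> x y w \<le> - (2 * s + w)\<^sup>2 / (2 * m)"
    by (rule le) (simp add: s_def)
  then have "(2 * s + w)\<^sup>2 / (2 * m) \<le> (2 * x + w)\<^sup>2 / (2 * m)"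
    unfolding L using r by simp
  then have "(2 * s + w)\<^sup>2 \<le> (2 * x + w)\<^sup>2"
    using m by (simp add: divide_le_cancel)
  then have "\<bar>2 * s + w\<bar> \<le> \<bar>2 * x + w\<bar>" by (simp add: abs_le_square_iff)
  moreover have "2 \<le> \<bar>2 * s + w\<bar>" by (simp add: s_def)
  ultimately have "2 \<le> \<bar>2 * x + w\<bar>" by linarith
  then have "2 / m \<le> \<bar>2 * x + w\<bar> / m"
    using m by (intro divide_right_mono) auto
  then show ?thesis using m by (simp add: r abs_divide flip: m_def)
qed

lemma ALM_not_convergent:
  assumes "\<tau> > 0" and \<beta>: "\<And>k. \<beta> k > 2" and "bounded (range \<beta>)"
    and ALM: "ALM_sequence \<tau> \<beta> x y w"
  shows "\<not> convergent w"
proof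
  assume "convergent w"
  then obtain l where "w \<longlonglongrightarrow> l" by (auto simp: convergent_def)
  then have "(\<lambda>k. w (Suc k) - w k) \<longlonglongrightarrow> l - l"
    by (intro tendsto_diff LIMSEQ_Suc)
  then have lim: "(\<lambda>k. \<bar>w (Suc k) - w k\<bar>) \<longlonglongrightarrow> 0"
    by (simp add: tendsto_rabs_zero_iff)
  obtain B where B: "\<And>k. \<bar>\<beta> k\<bar> \<le> B"
    using \<open>bounded (range \<beta>)\<close> by (auto simp: bounded_iff)
  have "B > 2" using \<beta>[of 0] B[of 0] by linarith
  have step: "\<tau> * (2 / (B - 2)) \<le> \<bar>w (Suc k) - w k\<bar>" for k
  proof -
    have "2 / (B - 2) \<le> 2 / (\<beta> k - 2)"
      using \<beta>[of k] B[of k] by (intro divide_left_mono) auto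
    also have "\<dots> \<le> \<bar>x (Suc k) - y (Suc k)\<bar>"
      using ALM \<beta>[of k] by (intro ALM_step_infeasibility) (auto simp: ALM_sequence_def)
    finally have "\<tau> * (2 / (B - 2)) \<le> \<tau> * \<bar>x (Suc k) - y (Suc k)\<bar>"
      using \<open>\<tau> > 0\<close> by (intro mult_left_mono) auto
    also have "\<dots> = \<bar>w (Suc k) - w k\<bar>"
      using ALM \<open>\<tau> > 0\<close> by (simp add: ALM_sequence_def abs_mult)
    finally show ?thesis .
  qed
  then have "\<tau> * (2 / (B - 2)) \<le> 0"
    by (intro LIMSEQ_le_const[OF lim]) auto
  moreover have "\<tau> * (2 / (B - 2)) > 0" using \<open>\<tau> > 0\<close> \<open>B > 2\<close> by simp
  ultimately show False by simp
qed

section \<open>Finite convergence of ADMM\<close>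

lemma ADMM_x_step:
  assumes "\<beta> > -2"
    and min: "is_arg_min (\<lambda>u. aug_lagrangian \<beta> u y w) (\<lambda>u. u \<in> {-1..1}) x"
  shows "x = max (-1) (min 1 ((\<beta> * y - w) / (\<beta> + 2)))"
proof -
  define n c where "n = \<beta> + 2" and "c = (\<beta> * y - w) / (\<beta> + 2)"
  \<comment> \<open>Eliminating \<open>w\<close> in favour of \<open>c\<close> makes the completed square a polynomial identity.\<close>
  have "n * c = \<beta> * y - w" using assms(1) by (simp add: n_def c_def)
  then have w: "w = \<beta> * y - n * c" by simp
  have "(\<lambda>u. aug_lagrangian \<beta> u y w) =
        (\<lambda>u. n / 2 * (u - c)\<^sup>2 + (- y\<^sup>2 - w * y + \<beta> / 2 * y\<^sup>2 - n / 2 * c\<^sup>2))"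
    by (rule ext, simp only: w) (simp add: aug_lagrangian_def n_def power2_eq_square field_simps)
  then have "is_arg_min
      (\<lambda>u. n / 2 * (u - c)\<^sup>2 + (- y\<^sup>2 - w * y + \<beta> / 2 * y\<^sup>2 - n / 2 * c\<^sup>2)) (\<lambda>u. u \<in> {-1..1}) x"
    using min by simp
  then show ?thesis
    using argmin_square_interval[of "n / 2" "-1" 1] assms(1) unfolding c_def n_def by simp
qed

lemma ADMM_y_step:
  assumes "\<beta> > 2"
    and min: "is_arg_min (\<lambda>v. aug_lagrangian \<beta> x v w) (\<lambda>v. True) y"
  shows "y = (\<beta> * x + w) / (\<beta> - 2)"
proof -
  define m c where "m = \<beta> - 2" and "c = (\<beta> * x + w) / (\<beta> - 2)"
  \<comment> \<open>Eliminating \<open>w\<close> in favour of \<open>c\<close> makes the completed square a polynomial identity.\<close>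
  have "m * c = \<beta> * x + w" using assms(1) by (simp add: m_def c_def)
  then have w: "w = m * c - \<beta> * x" by simp
  have "(\<lambda>v. aug_lagrangian \<beta> x v w) =
        (\<lambda>v. m / 2 * (v - c)\<^sup>2 + (x\<^sup>2 + w * x + \<beta> / 2 * x\<^sup>2 - m / 2 * c\<^sup>2))"
    by (rule ext, simp only: w) (simp add: aug_lagrangian_def m_def power2_eq_square field_simps)
  then have "is_arg_min
      (\<lambda>v. m / 2 * (v - c)\<^sup>2 + (x\<^sup>2 + w * x + \<beta> / 2 * x\<^sup>2 - m / 2 * c\<^sup>2)) (\<lambda>v. True) y"
    using min by simp
  then show ?thesis
    using argmin_square_UNIV[of "m / 2"] assms(1) unfolding c_def m_def by simp
qed

text \<open>
  The stationarity condition of the \<open>y\<close>-step, \<open>-2 y - w - \<beta> (x - y) = 0\<close>, contains the multiplier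
  update. The initial multiplier is arbitrary, so the relation \<open>w = -2 y\<close>, and with it the
  reduction to a recursion in \<open>y\<close>, is available only from index 1 on.
\<close>

lemma ADMM_sequence_reduction:
  assumes "\<beta> > 2" and ADMM: "ADMM_sequence \<beta> x y w"
  shows "w (Suc k) = -2 * y (Suc k)"
    and "x (Suc (Suc k)) = max (-1) (min 1 (y (Suc k)))"
    and "y (Suc (Suc k)) = (\<beta> * x (Suc (Suc k)) - 2 * y (Suc k)) / (\<beta> - 2)"
proof -
  have y_step: "y (Suc j) = (\<beta> * x (Suc j) + w j) / (\<beta> - 2)" for j
    using ADMM assms(1) by (intro ADMM_y_step) (auto simp: ADMM_sequence_def)
  have "(\<beta> - 2) * y (Suc k) = \<beta> * x (Suc k) + w k"
    using y_step[of k] assms(1) by simp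
  moreover have "w (Suc k) = w k + \<beta> * (x (Suc k) - y (Suc k))"
    using ADMM by (simp add: ADMM_sequence_def)
  ultimately show w: "w (Suc k) = -2 * y (Suc k)"
    by (simp add: algebra_simps)
  have "x (Suc (Suc k)) = max (-1) (min 1 ((\<beta> * y (Suc k) - w (Suc k)) / (\<beta> + 2)))"
  proof (rule ADMM_x_step)
    show "\<beta> > -2" using assms(1) by simp
    show "is_arg_min (\<lambda>u. aug_lagrangian \<beta> u (y (Suc k)) (w (Suc k))) (\<lambda>u. u \<in> {-1..1})
        (x (Suc (Suc k)))"
      using ADMM unfolding ADMM_sequence_def by blast
  qed
  moreover have "(\<beta> * y (Suc k) - w (Suc k)) / (\<beta> + 2) = y (Suc k)"
    using assms(1) by (simp add: w divide_eq_eq algebra_simps)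
  ultimately show "x (Suc (Suc k)) = max (-1) (min 1 (y (Suc k)))" by simp
  show "y (Suc (Suc k)) = (\<beta> * x (Suc (Suc k)) - 2 * y (Suc k)) / (\<beta> - 2)"
    using y_step[of "Suc k"] by (simp add: w)
qed

text \<open>
  Writing \<open>t = p + e\<close> with \<open>p\<close> the projection of \<open>t\<close>, the step sends \<open>p + e\<close> to \<open>p - q e\<close> where
  \<open>q = 2 / (\<beta> - 2) < 1\<close>. If \<open>e \<noteq> 0\<close> then \<open>p\<close> is an endpoint, and the image is either in the
  interval or at distance \<open>q \<bar>e\<bar> - 2\<close> beyond the opposite endpoint.
\<close>

lemma reflection_step_decrease:
  fixes \<beta> t :: real
  assumes "\<beta> > 4"
  defines "t' \<equiv> (\<beta> * max (-1) (min 1 t) - 2 * t) / (\<beta> - 2)"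
  shows "\<bar>t'\<bar> \<le> 1 \<or> \<bar>t'\<bar> \<le> \<bar>t\<bar> - 2"
proof -
  define p q where "p = max (-1) (min 1 t)" and "q = 2 / (\<beta> - 2)"
  have q: "0 < q" "q < 1" using assms(1) by (auto simp: q_def)
  have t': "t' = p - q * (t - p)"
    using assms(1) unfolding t'_def p_def[symmetric] q_def by (simp add: field_simps)
  consider "t > 1" | "\<bar>t\<bar> \<le> 1" | "t < -1" by linarith
  then show ?thesis
  proof cases
    case 1
    then have "t' = 1 - q * (t - 1)" using t' by (simp add: p_def)
    moreover have "q * (t - 1) \<ge> 0" "q * (t - 1) \<le> t - 1"
      using 1 q mult_right_mono[of q 1 "t - 1"] by auto
    ultimately show ?thesis using 1 by linarith
  next
    case 2
    then have "p = t" by (auto simp: p_def)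
    then show ?thesis using 2 t' by simp
  next
    case 3
    then have "t' = -1 - q * (t - (-1))" using t' by (simp add: p_def)
    moreover have "q * (-1 - t) \<ge> 0" "q * (-1 - t) \<le> -1 - t"
      using 3 q mult_right_mono[of q 1 "-1 - t"] by auto
    moreover have "q * (t - (-1)) = - (q * (-1 - t))" by (simp add: algebra_simps)
    ultimately show ?thesis using 3 by linarith
  qed
qed

lemma eventually_le_of_decrease:
  fixes a :: "nat \<Rightarrow> real"
  assumes "d > 0" and dec: "\<And>k. a (Suc k) \<le> b \<or> a (Suc k) \<le> a k - d"
  shows "\<exists>k. a k \<le> b"
proof (rule ccontr)
  assume "\<not> ?thesis"
  then have above: "a k > b" for k by (meson not_le)
  have bound: "a k \<le> a 0 - real k * d" for k
  proof (induction k)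
    case (Suc k)
    have "a (Suc k) \<le> a k - d" using dec[of k] above[of "Suc k"] by linarith
    then show ?case using Suc by (simp add: algebra_simps)
  qed simp
  obtain n where "a 0 - b < real n * d"
    using reals_Archimedean3[OF \<open>d > 0\<close>] by blast
  then show False using bound[of n] above[of n] by linarith
qed

lemma feasible_imp_solution:
  assumes "c \<in> {-1..1}"
  shows "is_solution (c, c)"
  using assms by (auto simp: is_solution_def is_arg_min_def objective_def feasible_def)

lemma ADMM_finite_convergence:
  assumes "\<beta> > 4" and ADMM: "ADMM_sequence \<beta> x y w"
  shows "\<exists>c K. c \<in> {-1..1} \<and> (\<forall>k\<ge>K. x k = c \<and> y k = c \<and> w k = -2 * c)"
proof -
  have "\<beta> > 2" using assms(1) by simp
  note red = ADMM_sequence_reduction[OF this ADMM]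
  have "\<exists>k. \<bar>y (Suc k)\<bar> \<le> 1"
  proof (rule eventually_le_of_decrease)
    show "\<bar>y (Suc (Suc k))\<bar> \<le> 1 \<or> \<bar>y (Suc (Suc k))\<bar> \<le> \<bar>y (Suc k)\<bar> - 2" for k
      unfolding red(3)[of k] red(2)[of k] by (rule reflection_step_decrease[OF assms(1)])
  qed simp
  then obtain K where K: "\<bar>y (Suc K)\<bar> \<le> 1" by blast
  define c where "c = y (Suc K)"
  have fixed: "x (Suc (Suc k)) = c \<and> y (Suc (Suc k)) = c" if "y (Suc k) = c" for k
  proof -
    have x: "x (Suc (Suc k)) = c"
      using red(2)[of k] K that by (auto simp: c_def)
    have "(\<beta> * c - 2 * c) / (\<beta> - 2) = c"
      using assms(1) by (simp add: divide_eq_eq algebra_simps)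
    then show ?thesis using red(3)[of k] x that by simp
  qed
  have y: "y (Suc (K + j)) = c" for j
    by (induction j) (use fixed in \<open>auto simp: c_def\<close>)
  have "x k = c \<and> y k = c \<and> w k = -2 * c" if k_ge: "k \<ge> Suc (Suc K)" for k
  proof -
    obtain j where k: "k = Suc (Suc (K + j))"
      using le_Suc_ex[OF k_ge] by auto
    show ?thesis
      unfolding k using fixed[OF y[of j]] red(1)[of "Suc (K + j)"] by simp
  qed
  moreover have "c \<in> {-1..1}" using K by (auto simp: c_def)
  ultimately show ?thesis by blast
qed

section \<open>ALM diverges, ADMM terminates\<close>

theorem proposition1:
  shows "(\<forall>(\<tau>::real) (\<beta>::nat \<Rightarrow> real) (x::nat \<Rightarrow> real) (y::nat \<Rightarrow> real) (w::nat \<Rightarrow> real).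
            \<tau> > 0 \<longrightarrow> (\<forall>k. \<beta> k > 2) \<longrightarrow> bounded (range \<beta>) \<longrightarrow> ALM_sequence \<tau> \<beta> x y w \<longrightarrow>
            \<not> convergent (\<lambda>k. (x k, y k, w k)))
       \<and> (\<forall>(\<beta>::real) (x::nat \<Rightarrow> real) (y::nat \<Rightarrow> real) (w::nat \<Rightarrow> real).
            \<beta> > 4 \<longrightarrow> ADMM_sequence \<beta> x y w \<longrightarrow>
            (\<exists>x' y' w'. is_solution (x', y') \<and>
               (\<exists>K. \<forall>k\<ge>K. (x k, y k, w k) = (x', y', w'))))"
proof (intro conjI allI impI)
  fix \<tau> :: real and \<beta> x y w :: "nat \<Rightarrow> real"
  assume "\<tau> > 0" "\<forall>k. \<beta> k > 2" "bounded (range \<beta>)" "ALM_sequence \<tau> \<beta> x y w"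
  then have "\<not> convergent w" using ALM_not_convergent by blast
  moreover have "convergent w" if lim: "convergent (\<lambda>k. (x k, y k, w k))"
  proof -
    obtain l where "(\<lambda>k. (x k, y k, w k)) \<longlonglongrightarrow> l"
      using lim by (auto simp: convergent_def)
    then have "(\<lambda>k. snd (snd (x k, y k, w k))) \<longlonglongrightarrow> snd (snd l)"
      by (intro tendsto_snd)
    then show ?thesis by (auto simp: convergent_def)
  qed
  ultimately show "\<not> convergent (\<lambda>k. (x k, y k, w k))" by blast
next
  fix \<beta> :: real and x y w :: "nat \<Rightarrow> real"
  assume "\<beta> > 4" "ADMM_sequence \<beta> x y w"
  then obtain c K where "c \<in> {-1..1}" and K: "\<forall>k\<ge>K. x k = c \<and> y k = c \<and> w k = -2 * c"
    using ADMM_finite_convergence by blast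
  then have "is_solution (c, c)" by (intro feasible_imp_solution)
  moreover have "\<forall>k\<ge>K. (x k, y k, w k) = (c, c, -2 * c)" using K by simp
  ultimately show "\<exists>x' y' w'. is_solution (x', y') \<and> (\<exists>K. \<forall>k\<ge>K. (x k, y k, w k) = (x', y', w'))"
    by blast
qed

end
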